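(* Let $(G,Z)\neq(\{1\},\emptyset)$ and $n\geq 1$. For $1\le i\neq j\le n$, $g,h\in G$ and $p,q\in Z\setminus\{p_\infty\}$, the following relations hold between differential forms on $X_n$: $$\omega_{ii}^p\wedge\omega_{ii}^q=0,\qquad \omega_{ij}^g=\omega_{ji}^{g^{-1}},$$ $$\omega_{ij}^h\wedge\omega_{jj}^p=\omega_{ij}^h\wedge\omega_{ii}^{h\cdot p}+\omega_{ii}^{h\cdot p}\wedge\omega_{jj}^p+\omega_{ii}^{h\cdot p_\infty}\wedge\omega_{ij}^h,$$ $$\omega_{ik}^h\wedge\omega_{jk}^g=\omega_{ij}^{hg^{-1}}\wedge(\omega_{jk}^g-\omega_{ik}^h)+\omega_{jj}^{g\cdot p_\infty}\wedge(\omega_{ij}^{hg^{-1}}-\omega_{jk}^g)+\omega_{ii}^{h\cdot p_\infty}\wedge(\omega_{ik}^h-\omega_{ij}^{hg^{-1}})+\omega_{ii}^{h\cdot p_\infty}\wedge\omega_{jj}^{g\cdot p_\infty}$$ for $k\in[1,n]\setminus\{i,j\}$, and, if $h\ne g$, $$\omega_{ij}^h\wedge\omega_{ij}^g=(\omega_{ii}^{p_1}+\omega_{ii}^{p_2})\wedge(\omega_{ij}^g-\omega_{ij}^h)-\omega_{ii}^{g\cdot p_\infty}\wedge\omega_{ij}^g+\omega_{ii}^{h\cdot p_\infty}\wedge\omega_{ij}^h,$$ where $p_1$ and $p_2$ are the two points of $\mathbb P^1$ fixed by $hg^{-1}$.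
   Context: $\mathbb P^1=\mathbb C\cup\{\infty\}$ is the complex projective line with $\mathrm{PGL}(\mathbb C^2)$ acting by homographies. $G$ is a finite subgroup of $\mathrm{PGL}(\mathbb C^2)$ and $Z\subset\mathbb P^1$ is a finite $G$-stable set containing all points with non-trivial stabilizer in $G$ (every non-trivial element of $G$ has exactly two fixed points). $X_n=\{(p_1,\dots,p_n)\in(\mathbb P^1\setminus Z)^n\mid p_i\neq g\cdot p_j\text{ for all }i\ne j,\ g\in G\}$. Fix $p_\infty\in Z$ and a homography $h_Z$ with $h_Z(p_\infty)=\infty$ (if $\infty\in Z$, take $p_\infty=\infty$, $h_Z=\mathrm{id}$). For a homography $h$ with matrix $\begin{pmatrix}a&b\\c&d\end{pmatrix}$ put $P_h(x,y)=x(cy+d)-(ay+b)$ (well defined up to a nonzero scalar) and $\omega^h(x,y)=dP_h/P_h$; for $p\in\mathbb C$ put $\omega^p(x)=dx/(x-p)$. The map $h_Z^{\times n}$ sends $X_n$ into $\mathbb C^n$ with coordinates $z_1,\dots,z_n$. On $X_n$ set $\omega_{kk}^p=\frac1{2\pi\sqrt{-1}}(h_Z^{\times n})^*\omega^{h_Z(p)}(z_k)$ for $p\in Z\setminus\{p_\infty\}$, and $\omega_{ij}^g=\frac1{2\pi\sqrt{-1}}(h_Z^{\times n})^*\omega^{h_Zgh_Z^{-1}}(z_i,z_j)$ for $i\ne j$, $g\in G$. Convention: $\omega_{kk}^{p_\infty}=0$. *)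

theory Defs
  imports
    "HOL-Analysis.Analysis"
    "HOL-Algebra.Group"
    "HOL-Library.Function_Algebras"
begin

section \<open>The projective line and its homographies\<close>

datatype proj_line = Fin (affine: complex) | Infty

definition homography :: "complex^2^2 \<Rightarrow> proj_line \<Rightarrow> proj_line" where
  "homography A p =
     (case p of
        Fin z \<Rightarrow>
          (if A$2$1 * z + A$2$2 = 0 then Infty
           else Fin ((A$1$1 * z + A$1$2) / (A$2$1 * z + A$2$2)))
      | Infty \<Rightarrow> (if A$2$1 = 0 then Infty else Fin (A$1$1 / A$2$1)))"

text \<open>\<open>PGL(\<complex>\<^sup>2)\<close> acts faithfully on the projective line and is identified with the group of
  homographies; \<open>homography_eq_iff\<close> and \<open>homography_mult\<close> below justify the identification.\<close>

definition PGL2 :: "(proj_line \<Rightarrow> proj_line) monoid" where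
  "PGL2 = \<lparr>carrier = {homography A |A. invertible A}, mult = (\<circ>), one = id\<rparr>"

lemma invertible_2: "invertible (A :: complex^2^2) \<longleftrightarrow> A$1$1 * A$2$2 - A$1$2 * A$2$1 \<noteq> 0"
  by (simp add: invertible_det_nz det_2)

lemma homography_mult:
  assumes "invertible A" "invertible B"
  shows "homography (A ** B) = homography A \<circ> homography B"
proof
  fix p
  let ?a = "A$1$1" and ?b = "A$1$2" and ?c = "A$2$1" and ?d = "A$2$2"
  let ?a' = "B$1$1" and ?b' = "B$1$2" and ?c' = "B$2$1" and ?d' = "B$2$2"
  have dA: "?a * ?d - ?b * ?c \<noteq> 0" and dB: "?a' * ?d' - ?b' * ?c' \<noteq> 0"
    using assms by (auto simp: invertible_2)
  have key: "homography A (if m = 0 then Infty else Fin (n / m)) =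
      (if ?c * n + ?d * m = 0 then Infty else Fin ((?a * n + ?b * m) / (?c * n + ?d * m)))"
    if "n \<noteq> 0 \<or> m \<noteq> 0" for n m
  proof (cases "m = 0")
    case False
    then have "?c * (n / m) + ?d = (?c * n + ?d * m) / m"
      and "?a * (n / m) + ?b = (?a * n + ?b * m) / m"
      by (simp_all add: field_simps)
    then show ?thesis using False by (simp add: homography_def)
  qed (use that in \<open>auto simp: homography_def\<close>)
  show "homography (A ** B) p = (homography A \<circ> homography B) p"
  proof (cases p)
    case (Fin z)
    let ?n = "?a' * z + ?b'" and ?m = "?c' * z + ?d'"
    have "?n \<noteq> 0 \<or> ?m \<noteq> 0"
    proof (rule ccontr)
      assume "\<not> (?n \<noteq> 0 \<or> ?m \<noteq> 0)"
      then have "?b' = - (?a' * z)" "?d' = - (?c' * z)"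
        by (auto simp: eq_neg_iff_add_eq_0 add.commute)
      then show False using dB by simp
    qed
    from key[OF this] show ?thesis using Fin
      by (simp add: homography_def matrix_matrix_mult_def sum_2 algebra_simps)
  next
    case Infty
    have "?a' \<noteq> 0 \<or> ?c' \<noteq> 0" using dB by auto
    from key[OF this] show ?thesis using Infty
      by (simp add: homography_def matrix_matrix_mult_def sum_2 algebra_simps)
  qed
qed

lemma homography_eq_iff:
  assumes "invertible A" "invertible B"
  shows "homography A = homography B \<longleftrightarrow> (\<exists>c. c \<noteq> 0 \<and> A = (\<chi> i j. c * B$i$j))"
proof
  assume "\<exists>c. c \<noteq> 0 \<and> A = (\<chi> i j. c * B$i$j)"
  then obtain c where c: "c \<noteq> 0" and A: "A = (\<chi> i j. c * B$i$j)" by blast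
  show "homography A = homography B"
  proof
    fix p
    have m: "c * B$2$1 * z + c * B$2$2 = c * (B$2$1 * z + B$2$2)"
      and n: "c * B$1$1 * z + c * B$1$2 = c * (B$1$1 * z + B$1$2)" for z
      by (simp_all add: algebra_simps)
    show "homography A p = homography B p"
      using c by (cases p) (simp_all add: A homography_def m n)
  qed
next
  assume eq: "homography A = homography B"
  have dA: "A$1$1 * A$2$2 - A$1$2 * A$2$1 \<noteq> 0" and dB: "B$1$1 * B$2$2 - B$1$2 * B$2$1 \<noteq> 0"
    using assms by (auto simp: invertible_2)
  have ratio: "\<exists>c. u = c * u' \<and> v = c * v'"
    if "(if v = 0 then Infty else Fin (u / v)) = (if v' = 0 then Infty else Fin (u' / v'))"
      "u' \<noteq> 0 \<or> v' \<noteq> 0" for u v u' v' :: complex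
  proof (cases "v' = 0")
    case True
    with that show ?thesis by (intro exI[of _ "u / u'"]) (auto split: if_splits)
  next
    case False
    with that show ?thesis
      by (intro exI[of _ "v / v'"]) (auto simp: field_simps split: if_splits)
  qed
  have "\<exists>c. A$1$1 = c * B$1$1 \<and> A$2$1 = c * B$2$1"
    using fun_cong[OF eq, of Infty] dB by (intro ratio) (auto simp: homography_def split: if_splits)
  then obtain c1 where c1: "A$1$1 = c1 * B$1$1" "A$2$1 = c1 * B$2$1" by blast
  have "\<exists>c. A$1$2 = c * B$1$2 \<and> A$2$2 = c * B$2$2"
    using fun_cong[OF eq, of "Fin 0"] dB by (intro ratio) (auto simp: homography_def split: if_splits)
  then obtain c2 where c2: "A$1$2 = c2 * B$1$2" "A$2$2 = c2 * B$2$2" by blast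
  have "B$1$1 + B$1$2 \<noteq> 0 \<or> B$2$1 + B$2$2 \<noteq> 0"
  proof (rule ccontr)
    assume "\<not> ?thesis"
    then have "B$1$2 = - B$1$1" "B$2$2 = - B$2$1"
      by (auto simp: eq_neg_iff_add_eq_0 add.commute)
    then show False using dB by simp
  qed
  then have "\<exists>c. A$1$1 + A$1$2 = c * (B$1$1 + B$1$2) \<and> A$2$1 + A$2$2 = c * (B$2$1 + B$2$2)"
    using fun_cong[OF eq, of "Fin 1"] by (intro ratio) (auto simp: homography_def split: if_splits)
  then obtain c3 where c3: "A$1$1 + A$1$2 = c3 * (B$1$1 + B$1$2)"
    "A$2$1 + A$2$2 = c3 * (B$2$1 + B$2$2)" by blast
  have e1: "(c1 - c3) * B$1$1 + (c2 - c3) * B$1$2 = 0"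
    and e2: "(c1 - c3) * B$2$1 + (c2 - c3) * B$2$2 = 0"
    using c1 c2 c3 by (simp_all add: algebra_simps)
  have "(c1 - c3) * (B$1$1 * B$2$2 - B$1$2 * B$2$1) =
      ((c1 - c3) * B$1$1 + (c2 - c3) * B$1$2) * B$2$2
      - ((c1 - c3) * B$2$1 + (c2 - c3) * B$2$2) * B$1$2"
    by (simp add: algebra_simps)
  then have "c1 = c3" using e1 e2 dB by simp
  moreover have "(c2 - c3) * (B$1$1 * B$2$2 - B$1$2 * B$2$1) =
      ((c1 - c3) * B$2$1 + (c2 - c3) * B$2$2) * B$1$1
      - ((c1 - c3) * B$1$1 + (c2 - c3) * B$1$2) * B$2$1"
    by (simp add: algebra_simps)
  then have "c2 = c3" using e1 e2 dB by simp
  ultimately have "A = (\<chi> i j. c3 * B$i$j)"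
    using c1 c2 by (simp add: vec_eq_iff forall_2)
  moreover have "c3 \<noteq> 0" using dA c1 \<open>c1 = c3\<close> by auto
  ultimately show "\<exists>c. c \<noteq> 0 \<and> A = (\<chi> i j. c * B$i$j)" by blast
qed

lemma group_PGL2: "group PGL2"
proof -
  have one: "homography (mat 1) = id"
    by (auto simp: fun_eq_iff homography_def mat_def split: proj_line.split)
  have inv1: "invertible (mat 1 :: complex^2^2)"
    unfolding invertible_def by (metis matrix_mul_lid)
  show ?thesis
  proof (rule groupI)
    fix x y assume "x \<in> carrier PGL2" "y \<in> carrier PGL2"
    then show "x \<otimes>\<^bsub>PGL2\<^esub> y \<in> carrier PGL2"
      by (auto simp: PGL2_def) (metis homography_mult invertible_mult)
  next
    show "\<one>\<^bsub>PGL2\<^esub> \<in> carrier PGL2" using one inv1 by (auto simp: PGL2_def) metis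
  next
    fix x assume "x \<in> carrier PGL2"
    then obtain A where A: "invertible A" "x = homography A" by (auto simp: PGL2_def)
    then obtain B where B: "A ** B = mat 1" "B ** A = mat 1" by (auto simp: invertible_def)
    then have "invertible B" by (auto simp: invertible_def)
    then show "\<exists>y\<in>carrier PGL2. y \<otimes>\<^bsub>PGL2\<^esub> x = \<one>\<^bsub>PGL2\<^esub>"
      using A B one homography_mult[of B A] by (auto simp: PGL2_def)
  qed (auto simp: PGL2_def o_assoc)
qed

section \<open>Differential forms\<close>

text \<open>
  A form of degree 1 or 2 is a function of a point and of one or two tangent vectors; sums and
  differences of forms are the pointwise ones of \<open>Function_Algebras\<close>. Forms on a subset \<open>X\<close> of a
  larger type are extended by zero outside \<open>X\<close>, so that equality of forms on \<open>X\<close> is \<open>=\<close>.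
\<close>

type_synonym ('p, 'v) form1 = "'p \<Rightarrow> 'v \<Rightarrow> complex"
type_synonym ('p, 'v) form2 = "'p \<Rightarrow> 'v \<Rightarrow> 'v \<Rightarrow> complex"

definition wedge :: "('p, 'v) form1 \<Rightarrow> ('p, 'v) form1 \<Rightarrow> ('p, 'v) form2"  (infixl "\<and>\<^sub>f" 70)
  where "\<alpha> \<and>\<^sub>f \<beta> = (\<lambda>x v w. \<alpha> x v * \<beta> x w - \<alpha> x w * \<beta> x v)"

definition d0 :: "('v::real_normed_vector \<Rightarrow> complex) \<Rightarrow> ('v, 'v) form1"
  where "d0 f = (\<lambda>z v. frechet_derivative f (at z) v)"

definition omega_pt :: "complex \<Rightarrow> ('v::real_normed_vector \<Rightarrow> complex) \<Rightarrow> ('v, 'v) form1"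
  where "omega_pt p x = (\<lambda>z v. d0 x z v / (x z - p))"

definition P_mat :: "complex^2^2 \<Rightarrow> complex \<Rightarrow> complex \<Rightarrow> complex"
  where "P_mat A x y = x * (A$2$1 * y + A$2$2) - (A$1$1 * y + A$1$2)"

definition omega_mat ::
    "complex^2^2 \<Rightarrow> ('v::real_normed_vector \<Rightarrow> complex) \<Rightarrow> ('v \<Rightarrow> complex) \<Rightarrow> ('v, 'v) form1"
  where "omega_mat A x y = (\<lambda>z v. d0 (\<lambda>z. P_mat A (x z) (y z)) z v / P_mat A (x z) (y z))"

definition matrix_of :: "(proj_line \<Rightarrow> proj_line) \<Rightarrow> complex^2^2"
  where "matrix_of h = (SOME A. invertible A \<and> homography A = h)"

text \<open>The choice of the matrix is irrelevant: see \<open>omega_hom_homography\<close>.\<close>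

definition omega_hom ::
    "(proj_line \<Rightarrow> proj_line) \<Rightarrow> ('v::real_normed_vector \<Rightarrow> complex) \<Rightarrow> ('v \<Rightarrow> complex)
      \<Rightarrow> ('v, 'v) form1"
  where "omega_hom h = omega_mat (matrix_of h)"

lemma omega_hom_homography:
  assumes "invertible A"
  shows "omega_hom (homography A) (\<lambda>z. z $ i) (\<lambda>z. z $ j) = omega_mat A (\<lambda>z. z $ i) (\<lambda>z. z $ j)"
proof -
  let ?M = "matrix_of (homography A)"
  have "invertible ?M \<and> homography ?M = homography A"
    unfolding matrix_of_def by (rule someI[of _ A]) (use assms in simp)
  then obtain c where c: "c \<noteq> 0" and M: "?M = (\<chi> i j. c * A$i$j)"
    using homography_eq_iff assms by blast
  have P: "P_mat ?M x y = c * P_mat A x y" for x y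
    by (simp add: M P_mat_def algebra_simps)
  have "((\<lambda>z. c * P_mat A (z $ i) (z $ j)) has_derivative
      (\<lambda>v. c * frechet_derivative (\<lambda>z. P_mat A (z $ i) (z $ j)) (at z) v)) (at z)" for z
  proof -
    have "(\<lambda>z. P_mat A (z $ i) (z $ j)) differentiable (at z)"
      unfolding P_mat_def
      by (intro derivative_intros bounded_linear_imp_differentiable bounded_linear_vec_nth)
    then show ?thesis
      by (intro has_derivative_mult_right) (simp flip: frechet_derivative_works)
  qed
  then have "frechet_derivative (\<lambda>z. c * P_mat A (z $ i) (z $ j)) (at z) =
      (\<lambda>v. c * frechet_derivative (\<lambda>z. P_mat A (z $ i) (z $ j)) (at z) v)" for z
    by (rule frechet_derivative_at[symmetric])
  then show ?thesis
    using c by (simp add: omega_hom_def omega_mat_def d0_def P)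
qed

section \<open>The orbit configuration space and its forms\<close>

definition orbit_conf ::
    "(proj_line \<Rightarrow> proj_line) set \<Rightarrow> proj_line set \<Rightarrow> (proj_line^'n) set"
  where "orbit_conf G Z =
    {x. (\<forall>i. x$i \<notin> Z) \<and> (\<forall>i j. i \<noteq> j \<longrightarrow> (\<forall>g\<in>G. x$i \<noteq> g (x$j)))}"

text \<open>
  The tangent space of the projective line at \<open>p\<close> is identified with \<open>\<complex>\<close> by a coordinate centred
  at \<open>p\<close>: it is \<open>z - p\<close> if \<open>p\<close> is finite, and \<open>1 / z\<close> at infinity. Below is its inverse.
  Accordingly, the tangent space of \<open>(proj_line)^'n\<close> at each point is \<open>complex^'n\<close>.
\<close>

definition centred_param :: "proj_line \<Rightarrow> complex \<Rightarrow> proj_line"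
  where "centred_param p t =
    (case p of Fin a \<Rightarrow> Fin (a + t) | Infty \<Rightarrow> (if t = 0 then Infty else Fin (1 / t)))"

definition differential :: "(proj_line^'n \<Rightarrow> complex^'n) \<Rightarrow> proj_line^'n \<Rightarrow> complex^'n \<Rightarrow> complex^'n"
  where "differential F x =
    frechet_derivative (\<lambda>t. F (\<chi> i. centred_param (x$i) (t$i))) (at 0)"

definition pullback ::
    "(proj_line^'n) set \<Rightarrow> (proj_line^'n \<Rightarrow> complex^'n) \<Rightarrow> (complex^'n, complex^'n) form1
      \<Rightarrow> (proj_line^'n, complex^'n) form1"
  where "pullback X F \<eta> = (\<lambda>x v. if x \<in> X then \<eta> (F x) (differential F x v) else 0)"

text \<open>The map induced by \<open>h\<close> on coordinates; \<open>affine\<close> is unspecified at infinity, which is not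
  reached from \<open>orbit_conf G Z\<close> when the pole of \<open>h\<close> lies in \<open>Z\<close>.\<close>

definition coord_map :: "(proj_line \<Rightarrow> proj_line) \<Rightarrow> proj_line^'n \<Rightarrow> complex^'n"
  where "coord_map h x = (\<chi> i. affine (h (x$i)))"

lemma coord_map_differentiable:
  fixes x :: "proj_line^'n"
  assumes "h \<in> carrier PGL2" and "\<And>i. h (x$i) \<noteq> Infty"
  shows "(\<lambda>t. coord_map h (\<chi> i. centred_param (x$i) (t$i))) differentiable (at 0)"
proof -
  obtain A where A: "invertible A" "h = homography A" using assms by (auto simp: PGL2_def)
  let ?a = "A$1$1" and ?b = "A$1$2" and ?c = "A$2$1" and ?d = "A$2$2"
  have *: "\<exists>f. f differentiable (at 0) \<and>
      (\<forall>\<^sub>F s in nhds 0. affine (h (centred_param p s)) = f s)" if "h p \<noteq> Infty" for p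
  proof (cases p)
    case (Fin z)
    let ?f = "\<lambda>s. (?a * (z + s) + ?b) / (?c * (z + s) + ?d)"
    have nz: "?c * (z + 0) + ?d \<noteq> 0" using that Fin by (auto simp: A homography_def)
    have "\<forall>\<^sub>F s in nhds 0. ?c * (z + s) + ?d \<noteq> 0"
      by (rule tendsto_imp_eventually_ne[OF _ nz]) (intro tendsto_intros filterlim_ident)
    then have "\<forall>\<^sub>F s in nhds 0. affine (h (centred_param p s)) = ?f s"
      by eventually_elim (simp add: Fin A homography_def centred_param_def)
    moreover have "?f differentiable (at 0)"
      using nz by (intro derivative_intros) auto
    ultimately show ?thesis by blast
  next
    case Infty
    let ?f = "\<lambda>s. (?a + ?b * s) / (?c + ?d * s)"
    have nz: "?c + ?d * 0 \<noteq> 0" using that Infty by (auto simp: A homography_def)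
    have "\<forall>\<^sub>F s in nhds 0. ?c + ?d * s \<noteq> 0"
      by (rule tendsto_imp_eventually_ne[OF _ nz]) (intro tendsto_intros filterlim_ident)
    then have "\<forall>\<^sub>F s in nhds 0. affine (h (centred_param p s)) = ?f s"
    proof eventually_elim
      case (elim s)
      show ?case
      proof (cases "s = 0")
        case True
        then show ?thesis using nz by (simp add: Infty A homography_def centred_param_def)
      next
        case False
        then have "?c * (1 / s) + ?d = (?c + ?d * s) / s" "?a * (1 / s) + ?b = (?a + ?b * s) / s"
          by (simp_all add: field_simps)
        then show ?thesis
          using False elim by (simp add: Infty A homography_def centred_param_def)
      qed
    qed
    moreover have "?f differentiable (at 0)"
      using nz by (intro derivative_intros) auto
    ultimately show ?thesis by blast
  qed
  have "(\<lambda>t. \<chi> i. affine (h (centred_param (x$i) (t$i)))) differentiable (at (0 :: complex^'n))"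
  proof -
    have "(\<lambda>t. affine (h (centred_param (x$i) (t$i)))) differentiable (at (0 :: complex^'n))" for i
    proof -
      obtain f where f: "f differentiable (at 0)"
        and ev: "\<forall>\<^sub>F s in nhds 0. affine (h (centred_param (x$i) s)) = f s"
        using * assms(2) by blast
      have tend: "((\<lambda>t::complex^'n. t $ i) \<longlongrightarrow> 0) (nhds 0)"
        by (rule tendsto_eq_rhs[OF tendsto_vec_nth[OF filterlim_ident]]) simp
      have "\<forall>\<^sub>F t in nhds (0 :: complex^'n). affine (h (centred_param (x$i) (t$i))) = f (t$i)"
        by (rule eventually_compose_filterlim[OF ev tend])
      then have ev': "\<forall>\<^sub>F t in nhds (0 :: complex^'n). f (t$i) = affine (h (centred_param (x$i) (t$i)))"
        by eventually_elim simp
      obtain f' where f': "(f has_derivative f') (at 0)" using f by (auto simp: differentiable_def)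
      have "((\<lambda>t::complex^'n. f (t$i)) has_derivative (\<lambda>t. f' (t$i))) (at 0)"
        by (rule has_derivative_compose[OF bounded_linear_imp_has_derivative])
          (auto intro: bounded_linear_vec_nth f')
      then have "((\<lambda>t::complex^'n. affine (h (centred_param (x$i) (t$i)))) has_derivative
          (\<lambda>t. f' (t$i))) (at 0)"
        by (rule has_derivative_transform_eventually)
          (use ev' in \<open>auto simp: eventually_nhds_conv_at\<close>)
      then show ?thesis by (auto simp: differentiable_def)
    qed
    then show ?thesis
      by (subst differentiable_componentwise_within)
        (auto simp: Basis_vec_def inner_axis intro!: differentiable_inner)
  qed
  then show ?thesis by (simp add: coord_map_def)
qed

definition omega_diag ::
    "(proj_line \<Rightarrow> proj_line) set \<Rightarrow> proj_line set \<Rightarrow> proj_line \<Rightarrow> (proj_line \<Rightarrow> proj_line)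
      \<Rightarrow> 'n::finite \<Rightarrow> proj_line \<Rightarrow> (proj_line^'n, complex^'n) form1"
  where "omega_diag G Z pinf hZ k p =
    (if p = pinf then 0
     else (\<lambda>x v. 1 / (2 * of_real pi * \<i>) *
            pullback (orbit_conf G Z) (coord_map hZ)
              (omega_pt (affine (hZ p)) (\<lambda>z. z$k)) x v))"

definition omega_pair ::
    "(proj_line \<Rightarrow> proj_line) set \<Rightarrow> proj_line set \<Rightarrow> (proj_line \<Rightarrow> proj_line)
      \<Rightarrow> 'n::finite \<Rightarrow> 'n \<Rightarrow> (proj_line \<Rightarrow> proj_line) \<Rightarrow> (proj_line^'n, complex^'n) form1"
  where "omega_pair G Z hZ i j g =
    (\<lambda>x v. 1 / (2 * of_real pi * \<i>) *
       pullback (orbit_conf G Z) (coord_map hZ)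
         (omega_hom (hZ \<otimes>\<^bsub>PGL2\<^esub> g \<otimes>\<^bsub>PGL2\<^esub> inv\<^bsub>PGL2\<^esub> hZ) (\<lambda>z. z$i) (\<lambda>z. z$j)) x v)"

end

theory Submission
  imports Defs
begin

text \<open>
  On the coordinates $x$, $y$ of two different points, all forms are logarithmic differentials of
  polynomials. If $A$, $B$ are matrices of $h$, $g$, then $P_A(x, z) = L(x) z + M(x)$ and
  $P_B(y, z) = K(y) z + N(y)$, where $L$ and $K$ are the denominators at the images of $\infty$
  under $h$ and $g$, and eliminating $z$ gives $L P_B - K P_A = P_{A B^{-1}}(x, y)$ up to scaling.
  A relation $R = S - T$ between nonzero functions implies
  $d\log S \wedge d\log T = d\log R \wedge (d\log T - d\log S)$. Applied to $S = L P_B$ and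
  $T = K P_A$ this is the fourth relation; the fifth is its restriction to the diagonal $x = y$,
  where $P_{A B^{-1}}(x, x)$ splits into the factors of the two fixed points of $h g^{-1}$; for
  the third one, $P_B$ is replaced by the linear function of the second point that vanishes
  at $p$.
\<close>

section \<open>Homogeneous coordinates\<close>

text \<open>Homogeneous coordinates treat finite points and infinity alike, so that homographies
  become linear maps. The pair (0, 0) also gets the value \<open>Infty\<close>, which is why later
  statements ask for a nonzero pair.\<close>

definition hom_pt :: "complex \<Rightarrow> complex \<Rightarrow> proj_line"
  where "hom_pt u v = (if v = 0 then Infty else Fin (u / v))"

lemma hom_pt_cases:
  obtains u v where "u \<noteq> 0 \<or> v \<noteq> 0" "p = hom_pt u v"
proof (cases p)
  case (Fin z)
  then show ?thesis using that[of z 1] by (simp add: hom_pt_def)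
next
  case Infty
  then show ?thesis using that[of 1 0] by (simp add: hom_pt_def)
qed

lemma hom_pt_eq_iff:
  assumes "u \<noteq> 0 \<or> v \<noteq> 0" "u' \<noteq> 0 \<or> v' \<noteq> 0"
  shows "hom_pt u v = hom_pt u' v' \<longleftrightarrow> u * v' = u' * v"
  using assms by (auto simp: hom_pt_def field_simps)

lemma mult_vec_nonzero:
  fixes A :: "complex^2^2"
  assumes "invertible A" "u \<noteq> 0 \<or> v \<noteq> 0"
  shows "A$1$1 * u + A$1$2 * v \<noteq> 0 \<or> A$2$1 * u + A$2$2 * v \<noteq> 0"
proof (rule ccontr)
  assume "\<not> ?thesis"
  then have e: "A$1$1 * u + A$1$2 * v = 0" "A$2$1 * u + A$2$2 * v = 0" by auto
  \<comment> \<open>Cramer's rule: multiplying the system by the adjugate leaves the determinant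
    times each coordinate.\<close>
  have "(A$1$1 * A$2$2 - A$1$2 * A$2$1) * u = 0" "(A$1$1 * A$2$2 - A$1$2 * A$2$1) * v = 0"
    using e by algebra+
  then show False using assms by (simp add: invertible_2)
qed

lemma homography_hom_pt:
  assumes "u \<noteq> 0 \<or> v \<noteq> 0"
  shows "homography A (hom_pt u v) = hom_pt (A$1$1 * u + A$1$2 * v) (A$2$1 * u + A$2$2 * v)"
proof (cases "v = 0")
  case True
  then show ?thesis using assms by (simp add: hom_pt_def homography_def)
next
  case False
  then have "A$2$1 * (u / v) + A$2$2 = (A$2$1 * u + A$2$2 * v) / v"
    and "A$1$1 * (u / v) + A$1$2 = (A$1$1 * u + A$1$2 * v) / v"
    by (simp_all add: field_simps)
  then show ?thesis using False by (simp add: hom_pt_def homography_def)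
qed

text \<open>The adjugate stands in for the inverse matrix: it differs from it by the determinant
  only, hence has the same homography, and its entries involve no division.\<close>

definition adj2 :: "complex^2^2 \<Rightarrow> complex^2^2"
  where "adj2 A = (\<chi> i j. if i = j then (if i = 1 then A$2$2 else A$1$1) else - A$i$j)"

lemma adj2_nth [simp]:
  "adj2 A $1$1 = A$2$2" "adj2 A $1$2 = - A$1$2" "adj2 A $2$1 = - A$2$1" "adj2 A $2$2 = A$1$1"
  by (simp_all add: adj2_def)

lemma invertible_adj2: "invertible A \<Longrightarrow> invertible (adj2 A)"
  by (simp add: invertible_2 algebra_simps)

lemma inv_PGL2_homography:
  assumes A: "invertible A"
  shows "inv\<^bsub>PGL2\<^esub> (homography A) = homography (adj2 A)"
proof -
  interpret group PGL2 by (rule group_PGL2)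
  have "homography (adj2 A) (homography A p) = p" for p
  proof -
    obtain u v where uv: "u \<noteq> 0 \<or> v \<noteq> 0" "p = hom_pt u v" by (rule hom_pt_cases)
    have "homography (adj2 A) (homography A p) =
        hom_pt ((A$1$1 * A$2$2 - A$1$2 * A$2$1) * u) ((A$1$1 * A$2$2 - A$1$2 * A$2$1) * v)"
      using mult_vec_nonzero[OF A uv(1)] uv
      by (simp add: homography_hom_pt) (simp add: algebra_simps)
    then show ?thesis using A uv by (auto simp: hom_pt_def invertible_2)
  qed
  then have "homography (adj2 A) \<otimes>\<^bsub>PGL2\<^esub> homography A = \<one>\<^bsub>PGL2\<^esub>"
    by (auto simp: PGL2_def fun_eq_iff)
  then show ?thesis
    using A invertible_adj2[OF A] by (intro inv_equality) (auto simp: PGL2_def)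
qed

text \<open>Polynomials that differ by a sign have the same logarithmic differential; this is the
  source of the symmetry between \<open>i\<close> and \<open>j\<close>.\<close>

lemma P_mat_adj2: "P_mat (adj2 A) y x = - P_mat A x y"
  by (simp add: P_mat_def algebra_simps)

text \<open>The coefficient of \<open>z\<close> in \<open>P_mat A x z\<close> is
  \<open>A$2$1 * x - A$1$1\<close>, so cross-multiplying by these coefficients cancels
  \<open>z\<close>. With the adjugate in place of the inverse the identity is exact, without a
  scalar factor.\<close>

lemma P_mat_elimination:
  "P_mat (A ** adj2 B) x y =
    (A$2$1 * x - A$1$1) * P_mat B y z - (B$2$1 * y - B$1$1) * P_mat A x z"
proof -
  have "P_mat (A ** adj2 B) x y =
      x * ((A$2$1 * B$2$2 - A$2$2 * B$2$1) * y + (A$2$2 * B$1$1 - A$2$1 * B$1$2))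
      - ((A$1$1 * B$2$2 - A$1$2 * B$2$1) * y + (A$1$2 * B$1$1 - A$1$1 * B$1$2))"
    by (simp add: P_mat_def matrix_matrix_mult_def sum_2)
  also have "\<dots> = (A$2$1 * x - A$1$1) * P_mat B y z - (B$2$1 * y - B$1$1) * P_mat A x z"
    unfolding P_mat_def by algebra
  finally show ?thesis .
qed

lemma P_mat_eq_0_imp:
  assumes A: "invertible A" and P: "P_mat A x y = 0"
  shows "homography A (Fin y) = Fin x"
proof -
  have nz: "A$1$1 * y + A$1$2 \<noteq> 0 \<or> A$2$1 * y + A$2$2 \<noteq> 0"
    using mult_vec_nonzero[OF A, of y 1] by simp
  have e: "x * (A$2$1 * y + A$2$2) = A$1$1 * y + A$1$2" using P by (simp add: P_mat_def)
  \<comment> \<open>If the denominator vanished, so would the numerator by \<open>e\<close>, against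
    \<open>nz\<close>.\<close>
  then have "A$2$1 * y + A$2$2 \<noteq> 0" using nz by auto
  then show ?thesis by (simp add: homography_def flip: e)
qed

section \<open>Values of the forms in coordinates\<close>

lemma d0_nth: "d0 (\<lambda>z::complex^'n. z$k) z v = v$k"
proof -
  have "((\<lambda>z::complex^'n. z$k) has_derivative (\<lambda>v. v$k)) (at z)"
    by (intro bounded_linear_imp_has_derivative bounded_linear_vec_nth)
  from frechet_derivative_at[OF this] show ?thesis by (simp add: d0_def)
qed

text \<open>The numerator consists of the two partial derivatives of \<open>P_mat A\<close>. The one
  in the second variable is the linear function by which the elimination identity
  multiplies.\<close>

lemma omega_hom_at:
  fixes z v :: "complex^'n"
  assumes "invertible A"
  shows "omega_hom (homography A) (\<lambda>z. z$i) (\<lambda>z. z$j) z v =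
    ((A$2$1 * z$j + A$2$2) * v$i + (A$2$1 * z$i - A$1$1) * v$j) / P_mat A (z$i) (z$j)"
proof -
  have n: "((\<lambda>z::complex^'n. z$k) has_derivative (\<lambda>v. v$k)) (at z)" for k
    by (intro bounded_linear_imp_has_derivative bounded_linear_vec_nth)
  have "((\<lambda>z. P_mat A (z$i) (z$j)) has_derivative
      (\<lambda>v. (A$2$1 * z$j + A$2$2) * v$i + (A$2$1 * z$i - A$1$1) * v$j)) (at z)"
    unfolding P_mat_def
    by (rule has_derivative_eq_rhs, (rule has_derivative_diff has_derivative_add has_derivative_mult has_derivative_const n)+)
      (simp add: fun_eq_iff algebra_simps)
  from frechet_derivative_at[OF this, symmetric]
  have "d0 (\<lambda>z. P_mat A (z$i) (z$j)) z v =
      (A$2$1 * z$j + A$2$2) * v$i + (A$2$1 * z$i - A$1$1) * v$j"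
    by (simp only: d0_def)
  then show ?thesis
    unfolding omega_hom_homography[OF assms] omega_mat_def by simp
qed

section \<open>Wedge products\<close>

lemma wedge_add_right: "\<alpha> \<and>\<^sub>f (\<beta> + \<gamma>) = \<alpha> \<and>\<^sub>f \<beta> + \<alpha> \<and>\<^sub>f \<gamma>"
  by (simp add: wedge_def fun_eq_iff algebra_simps)

lemma wedge_diff_right: "\<alpha> \<and>\<^sub>f (\<beta> - \<gamma>) = \<alpha> \<and>\<^sub>f \<beta> - \<alpha> \<and>\<^sub>f \<gamma>"
  by (simp add: wedge_def fun_eq_iff algebra_simps)

lemma wedge_swap: "\<alpha> \<and>\<^sub>f \<beta> = - (\<beta> \<and>\<^sub>f \<alpha>)"
  by (simp add: wedge_def fun_eq_iff)

lemma wedge_zero [simp]: "0 \<and>\<^sub>f \<beta> = 0" "\<alpha> \<and>\<^sub>f 0 = 0"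
  by (simp_all add: wedge_def fun_eq_iff)

text \<open>The hypotheses say $R = L Q - K P$ and $R\,d\log R = d(L Q) - d(K P)$ at the point \<open>x\<close>.\<close>

lemma wedge_three_term:
  fixes p q r l k :: "('p, 'v) form1"
  assumes R: "R = L * Q - K * P"
    and nz: "P \<noteq> 0" "Q \<noteq> 0" "L \<noteq> 0" "K \<noteq> 0"
    and dR: "\<And>v. R * r x v = Q * (L * l x v) + L * (Q * q x v) - (P * (K * k x v) + K * (P * p x v))"
  shows "(p \<and>\<^sub>f q) x v w =
    (r \<and>\<^sub>f (q - p) + k \<and>\<^sub>f (r - q) + l \<and>\<^sub>f (p - r) + l \<and>\<^sub>f k) x v w"
proof -
  \<comment> \<open>Up to the factors \<open>L * Q\<close> and \<open>K * P\<close>, these are the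
    logarithmic differentials of \<open>L * Q / R\<close> and \<open>K * P / R\<close>. They are
    proportional, so their wedge product vanishes; the rest is expansion of that product.\<close>
  have *: "L * Q * (l x v + q x v - r x v) = K * P * (k x v + p x v - r x v)" for v
    using dR[of v] R by (simp add: algebra_simps)
  have "(L * Q * (K * P)) * ((l x v + q x v - r x v) * (k x w + p x w - r x w)) =
      (L * Q * (l x v + q x v - r x v)) * (K * P * (k x w + p x w - r x w))"
    by (simp only: ac_simps)
  also have "\<dots> = (L * Q * (K * P)) * ((k x v + p x v - r x v) * (l x w + q x w - r x w))"
    unfolding *[of v] *[of w, symmetric] by (simp only: ac_simps)
  finally have "(l x v + q x v - r x v) * (k x w + p x w - r x w) =
      (k x v + p x v - r x v) * (l x w + q x w - r x w)"
    using nz by simp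
  moreover have "(p \<and>\<^sub>f q) x v w -
      (r \<and>\<^sub>f (q - p) + k \<and>\<^sub>f (r - q) + l \<and>\<^sub>f (p - r) + l \<and>\<^sub>f k) x v w =
      (k x v + p x v - r x v) * (l x w + q x w - r x w)
      - (l x v + q x v - r x v) * (k x w + p x w - r x w)"
    by (simp add: wedge_def algebra_simps)
  ultimately show ?thesis by simp
qed

text \<open>In the basis formed by its two zeros, a binary quadratic form retains only the mixed
  term. The two coordinates in this basis are, up to sign, the linear forms vanishing at the zeros,
  divided by the determinant \<open>D\<close>. A zero at infinity is included.\<close>

lemma binary_quadratic_factorization:
  fixes \<alpha> \<beta> \<gamma> :: complex
  assumes "\<alpha> * u\<^sub>1\<^sup>2 + \<beta> * (u\<^sub>1 * v\<^sub>1) + \<gamma> * v\<^sub>1\<^sup>2 = 0" "\<alpha> * u\<^sub>2\<^sup>2 + \<beta> * (u\<^sub>2 * v\<^sub>2) + \<gamma> * v\<^sub>2\<^sup>2 = 0"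
    and ne: "u\<^sub>1 * v\<^sub>2 \<noteq> u\<^sub>2 * v\<^sub>1"
  obtains c where "\<alpha> = c * (v\<^sub>1 * v\<^sub>2)" "\<beta> = - c * (u\<^sub>1 * v\<^sub>2 + u\<^sub>2 * v\<^sub>1)" "\<gamma> = c * (u\<^sub>1 * u\<^sub>2)"
proof -
  define D where "D = u\<^sub>1 * v\<^sub>2 - u\<^sub>2 * v\<^sub>1"
  have D: "D \<noteq> 0" using ne by (simp add: D_def)
  \<comment> \<open>The coefficient of the mixed term: the value at \<open>s\<close> times the first
    zero plus \<open>t\<close> times the second is \<open>b * s * t\<close>. Hence the factor is
    \<open>- b / D\<^sup>2\<close>.\<close>
  define b where "b = 2 * \<alpha> * (u\<^sub>1 * u\<^sub>2) + \<beta> * (u\<^sub>1 * v\<^sub>2 + u\<^sub>2 * v\<^sub>1) + 2 * \<gamma> * (v\<^sub>1 * v\<^sub>2)"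
  let ?q\<^sub>1 = "\<alpha> * u\<^sub>1\<^sup>2 + \<beta> * (u\<^sub>1 * v\<^sub>1) + \<gamma> * v\<^sub>1\<^sup>2"
    and ?q\<^sub>2 = "\<alpha> * u\<^sub>2\<^sup>2 + \<beta> * (u\<^sub>2 * v\<^sub>2) + \<gamma> * v\<^sub>2\<^sup>2"
  have "D\<^sup>2 * \<alpha> = ?q\<^sub>1 * v\<^sub>2\<^sup>2 + ?q\<^sub>2 * v\<^sub>1\<^sup>2 - b * (v\<^sub>1 * v\<^sub>2)"
    "D\<^sup>2 * \<beta> = b * (u\<^sub>1 * v\<^sub>2 + u\<^sub>2 * v\<^sub>1) - 2 * (?q\<^sub>1 * (u\<^sub>2 * v\<^sub>2) + ?q\<^sub>2 * (u\<^sub>1 * v\<^sub>1))"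
    "D\<^sup>2 * \<gamma> = ?q\<^sub>1 * u\<^sub>2\<^sup>2 + ?q\<^sub>2 * u\<^sub>1\<^sup>2 - b * (u\<^sub>1 * u\<^sub>2)"
    by (simp_all add: D_def b_def power2_eq_square algebra_simps)
  then have "D\<^sup>2 * \<alpha> = - b * (v\<^sub>1 * v\<^sub>2)" "D\<^sup>2 * \<beta> = b * (u\<^sub>1 * v\<^sub>2 + u\<^sub>2 * v\<^sub>1)"
    "D\<^sup>2 * \<gamma> = - b * (u\<^sub>1 * u\<^sub>2)"
    unfolding assms(1,2) by simp_all
  then show thesis
    using D by (intro that[of "- b / D\<^sup>2"]) (simp_all add: field_simps)
qed

section \<open>The forms on the orbit configuration space\<close>

locale orbit_forms =
  fixes G :: "(proj_line \<Rightarrow> proj_line) set" and Z :: "proj_line set"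
    and pinf :: proj_line and hZ :: "proj_line \<Rightarrow> proj_line"
  assumes G_sub: "subgroup G PGL2"
    and Z_stable: "\<forall>g\<in>G. g ` Z \<subseteq> Z"
    and stab: "{p. \<exists>g\<in>G. g \<noteq> \<one>\<^bsub>PGL2\<^esub> \<and> g p = p} \<subseteq> Z"
    and pinf_in: "pinf \<in> Z"
    and hZ_hom: "hZ \<in> carrier PGL2" "hZ pinf = Infty"
begin

sublocale PGL: group PGL2 by (rule group_PGL2)

abbreviation "X \<equiv> orbit_conf G Z"
abbreviation "T \<equiv> coord_map hZ"
abbreviation "dT \<equiv> differential (coord_map hZ)"
abbreviation "\<omega>d \<equiv> omega_diag G Z pinf hZ"
abbreviation "\<omega> \<equiv> omega_pair G Z hZ"

section \<open>The action of \<open>G\<close> read in the coordinate \<open>hZ\<close>\<close>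

definition \<kappa> :: complex
  where "\<kappa> = 1 / (2 * of_real pi * \<i>)"

definition chart_conj :: "(proj_line \<Rightarrow> proj_line) \<Rightarrow> proj_line \<Rightarrow> proj_line"
  where "chart_conj g = hZ \<otimes>\<^bsub>PGL2\<^esub> g \<otimes>\<^bsub>PGL2\<^esub> inv\<^bsub>PGL2\<^esub> hZ"

lemma G_carrier: "g \<in> G \<Longrightarrow> g \<in> carrier PGL2"
  using subgroup.mem_carrier[OF G_sub] .

lemma inv_hZ: "(inv\<^bsub>PGL2\<^esub> hZ) (hZ p) = p"
  using PGL.l_inv[OF hZ_hom(1)] by (auto simp: PGL2_def dest: fun_cong)

lemma hZ_eq_iff: "hZ p = hZ q \<longleftrightarrow> p = q"
  using inv_hZ by metis

lemma chart_conj_hZ: "chart_conj g (hZ p) = hZ (g p)"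
  using inv_hZ by (simp add: chart_conj_def PGL2_def)

lemma chart_conj_matrix:
  assumes "g \<in> G"
  obtains A where "invertible A" "chart_conj g = homography A"
proof -
  have "chart_conj g \<in> carrier PGL2" using G_carrier[OF assms] hZ_hom by (simp add: chart_conj_def)
  then show thesis using that by (auto simp: PGL2_def)
qed

lemma chart_conj_mult_inv:
  assumes "h \<in> G" "g \<in> G"
  shows "chart_conj (h \<otimes>\<^bsub>PGL2\<^esub> inv\<^bsub>PGL2\<^esub> g) = chart_conj h \<otimes>\<^bsub>PGL2\<^esub> inv\<^bsub>PGL2\<^esub> chart_conj g"
proof -
  have "inv\<^bsub>PGL2\<^esub> hZ \<otimes>\<^bsub>PGL2\<^esub> (hZ \<otimes>\<^bsub>PGL2\<^esub> y) = y" if "y \<in> carrier PGL2" for y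
    using that hZ_hom(1) by (simp flip: PGL.m_assoc)
  then show ?thesis
    using assms hZ_hom(1) by (simp add: chart_conj_def G_carrier PGL.inv_mult_group PGL.m_assoc)
qed

lemma chart_conj_inv:
  assumes "g \<in> G"
  shows "chart_conj (inv\<^bsub>PGL2\<^esub> g) = inv\<^bsub>PGL2\<^esub> chart_conj g"
  using assms hZ_hom(1) by (simp add: chart_conj_def G_carrier PGL.inv_mult_group PGL.m_assoc)

lemma chart_conj_mult_inv_matrix:
  assumes "h \<in> G" "g \<in> G"
    "invertible A" "chart_conj h = homography A"
    "invertible B" "chart_conj g = homography B"
  shows "chart_conj (h \<otimes>\<^bsub>PGL2\<^esub> inv\<^bsub>PGL2\<^esub> g) = homography (A ** adj2 B)"
  using assms
  by (simp add: chart_conj_mult_inv inv_PGL2_homography homography_mult invertible_adj2)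
    (simp add: PGL2_def)

section \<open>Nonvanishing of the polynomials and values of the forms with denominators
  cleared\<close>

lemma hZ_conf:
  assumes "x \<in> X"
  shows "hZ (x$k) = Fin (T x $ k)"
proof -
  \<comment> \<open>The only pole of \<open>hZ\<close> is \<open>pinf\<close>, a point of
    \<open>Z\<close>, which configurations avoid; so \<open>affine\<close> is never evaluated at
    \<open>Infty\<close> here.\<close>
  have "x$k \<noteq> pinf" using assms pinf_in by (auto simp: orbit_conf_def)
  then have "hZ (x$k) \<noteq> Infty" using hZ_eq_iff hZ_hom(2) by metis
  then show ?thesis by (cases "hZ (x$k)") (auto simp: coord_map_def)
qed

lemma linear_nonzero:
  assumes "x \<in> X" "p \<in> Z" "u \<noteq> 0 \<or> v \<noteq> 0" "hZ p = hom_pt u v"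
  shows "v * T x $ k - u \<noteq> 0"
proof
  assume "v * T x $ k - u = 0"
  \<comment> \<open>Here \<open>v\<close> cannot be 0, since the equation would then force
    \<open>u = 0\<close> as well.\<close>
  then have "hom_pt u v = Fin (T x $ k)" using assms(3) by (auto simp: hom_pt_def field_simps)
  then have "p = x$k" using assms hZ_conf hZ_eq_iff by metis
  then show False using assms by (auto simp: orbit_conf_def)
qed

text \<open>A zero would place \<open>x$i\<close> on the orbit of \<open>x$j\<close>, which
  \<open>orbit_conf\<close> excludes.\<close>

lemma P_mat_nonzero:
  assumes "x \<in> X" "g \<in> G" "i \<noteq> j" "invertible A" "chart_conj g = homography A"
  shows "P_mat A (T x $ i) (T x $ j) \<noteq> 0"
proof
  assume "P_mat A (T x $ i) (T x $ j) = 0"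
  then have "hZ (g (x$j)) = hZ (x$i)"
    using P_mat_eq_0_imp[OF assms(4)] assms(5) hZ_conf[OF assms(1)] chart_conj_hZ by metis
  then have "x$i = g (x$j)" by (simp add: hZ_eq_iff)
  then show False using assms by (simp add: orbit_conf_def)
qed

text \<open>In the chart \<open>pinf\<close> has homogeneous coordinates (1, 0), so its image is the
  first column of the matrix. This is how the coefficients in the elimination identity lead to forms
  at \<open>g pinf\<close>.\<close>

lemma hZ_image_pinf:
  assumes "chart_conj g = homography A"
  shows "hZ (g pinf) = hom_pt (A$1$1) (A$2$1)"
  using homography_hom_pt[of 1 0 A] chart_conj_hZ[of g pinf] assms hZ_hom(2) by (simp add: hom_pt_def)

text \<open>Clearing the denominator absorbs the convention at \<open>pinf\<close>: there
  \<open>v = 0\<close>, the linear function is constant, and both sides vanish. Images such as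
  \<open>h p\<close> therefore need no case distinction on whether they equal
  \<open>pinf\<close>.\<close>

lemma diag_linear:
  assumes "x \<in> X" "p \<in> Z" "u \<noteq> 0 \<or> v \<noteq> 0" "hZ p = hom_pt u v"
  shows "(v * T x $ k - u) * \<omega>d k p x w = \<kappa> * (v * dT x w $ k)"
proof (cases "v = 0")
  case True
  then have "p = pinf" using assms(4) hZ_hom(2) hZ_eq_iff by (metis hom_pt_def)
  then show ?thesis using True by (simp add: omega_diag_def)
next
  case False
  then have "p \<noteq> pinf" using assms(4) hZ_hom(2) by (auto simp: hom_pt_def)
  moreover have "v * T x $ k - u \<noteq> 0" using linear_nonzero assms by blast
  moreover have "T x $ k - u / v = (v * T x $ k - u) / v" using False by (simp add: field_simps)
  ultimately show ?thesis
    using assms(1,4) False by (simp add: omega_diag_def pullback_def omega_pt_def d0_nth hom_pt_def \<kappa>_def)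
qed

lemma diag_image_pinf_linear:
  assumes "x \<in> X" "g \<in> G" "invertible A" "chart_conj g = homography A"
  shows "A$2$1 * T x $ k - A$1$1 \<noteq> 0"
    and "(A$2$1 * T x $ k - A$1$1) * \<omega>d k (g pinf) x w = \<kappa> * (A$2$1 * dT x w $ k)"
proof -
  have *: "g pinf \<in> Z" "A$1$1 \<noteq> 0 \<or> A$2$1 \<noteq> 0"
    using assms Z_stable pinf_in by (auto simp: invertible_2)
  note ** = assms(1) * hZ_image_pinf[OF assms(4)]
  show "A$2$1 * T x $ k - A$1$1 \<noteq> 0" by (rule linear_nonzero[OF **])
  show "(A$2$1 * T x $ k - A$1$1) * \<omega>d k (g pinf) x w = \<kappa> * (A$2$1 * dT x w $ k)"
    by (rule diag_linear[OF **])
qed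

text \<open>Together with \<open>diag_linear\<close>, this turns the differential hypothesis of
  \<open>wedge_three_term\<close> into a polynomial identity, with \<open>\<kappa>\<close> as a
  common factor.\<close>

lemma pair_linear:
  assumes "x \<in> X" "g \<in> G" "i \<noteq> j" "invertible A" "chart_conj g = homography A"
  shows "P_mat A (T x $ i) (T x $ j) * \<omega> i j g x w =
    \<kappa> * ((A$2$1 * T x $ j + A$2$2) * dT x w $ i + (A$2$1 * T x $ i - A$1$1) * dT x w $ j)"
  using P_mat_nonzero[OF assms] assms(1)
  by (simp add: omega_pair_def pullback_def assms(5) omega_hom_at[OF assms(4)] \<kappa>_def flip: chart_conj_def)

section \<open>The relations between the forms\<close>

lemma diag_outside: "x \<notin> X \<Longrightarrow> \<omega>d k p x = (\<lambda>_. 0)"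
  by (auto simp: omega_diag_def pullback_def)

lemma pair_outside: "x \<notin> X \<Longrightarrow> \<omega> i j g x = (\<lambda>_. 0)"
  by (auto simp: omega_pair_def pullback_def)

text \<open>At every point both forms are multiples of the same covector, the differential of the
  \<open>i\<close>-th coordinate. The points may equal \<open>pinf\<close>, as happens for images
  under \<open>G\<close> in the later relations.\<close>

lemma diag_wedge_diag: "\<omega>d i p \<and>\<^sub>f \<omega>d i q = 0"
  by (simp add: fun_eq_iff wedge_def omega_diag_def pullback_def omega_pt_def d0_nth)

lemma pair_swap:
  assumes "i \<noteq> j" "g \<in> G"
  shows "\<omega> i j g = \<omega> j i (inv\<^bsub>PGL2\<^esub> g)"
proof (intro ext)
  fix x w
  obtain A where A: "invertible A" "chart_conj g = homography A" using chart_conj_matrix assms by blast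
  note A' = invertible_adj2[OF A(1)]
  have c: "chart_conj (inv\<^bsub>PGL2\<^esub> g) = homography (adj2 A)"
    using assms A by (simp add: chart_conj_inv inv_PGL2_homography)
  have g': "inv\<^bsub>PGL2\<^esub> g \<in> G" using subgroup.m_inv_closed[OF G_sub] assms by blast
  show "\<omega> i j g x w = \<omega> j i (inv\<^bsub>PGL2\<^esub> g) x w"
  proof (cases "x \<in> X")
    case True
    have "P_mat A (T x $ i) (T x $ j) * \<omega> i j g x w =
        - (P_mat (adj2 A) (T x $ j) (T x $ i) * \<omega> j i (inv\<^bsub>PGL2\<^esub> g) x w)"
      unfolding pair_linear[OF True assms(2,1) A] pair_linear[OF True g' assms(1)[symmetric] A' c]
      by (simp add: algebra_simps)
    then have "P_mat A (T x $ i) (T x $ j) * \<omega> i j g x w =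
        P_mat A (T x $ i) (T x $ j) * \<omega> j i (inv\<^bsub>PGL2\<^esub> g) x w"
      by (simp add: P_mat_adj2)
    then show ?thesis using P_mat_nonzero[OF True assms(2,1) A] by simp
  qed (simp add: pair_outside)
qed

lemma pair_wedge_diag:
  assumes ij: "i \<noteq> j" and h: "h \<in> G" and p: "p \<in> Z" "p \<noteq> pinf"
  shows "\<omega> i j h \<and>\<^sub>f \<omega>d j p =
    \<omega> i j h \<and>\<^sub>f \<omega>d i (h p) + \<omega>d i (h p) \<and>\<^sub>f \<omega>d j p + \<omega>d i (h pinf) \<and>\<^sub>f \<omega> i j h"
proof (intro ext)
  fix x a b
  obtain A where A: "invertible A" "chart_conj h = homography A" using chart_conj_matrix h by blast
  obtain u v where uv: "u \<noteq> 0 \<or> v \<noteq> 0" "hZ p = hom_pt u v" by (rule hom_pt_cases)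
  let ?u = "A$1$1 * u + A$1$2 * v" and ?v = "A$2$1 * u + A$2$2 * v"
  have hp: "h p \<in> Z" using Z_stable h p(1) by blast
  have uv': "?u \<noteq> 0 \<or> ?v \<noteq> 0" using mult_vec_nonzero[OF A(1) uv(1)] .
  have hZhp: "hZ (h p) = hom_pt ?u ?v"
    using homography_hom_pt[OF uv(1)] chart_conj_hZ[of h p] A(2) uv(2) by simp
  \<comment> \<open>\<open>v\<close> plays the role of the nonzero constant \<open>K\<close> below;
    this is where \<open>p \<noteq> pinf\<close> enters.\<close>
  have "v \<noteq> 0" using uv(2) p(2) hZ_hom(2) hZ_eq_iff by (metis hom_pt_def)
  show "(\<omega> i j h \<and>\<^sub>f \<omega>d j p) x a b =
    (\<omega> i j h \<and>\<^sub>f \<omega>d i (h p) + \<omega>d i (h p) \<and>\<^sub>f \<omega>d j p + \<omega>d i (h pinf) \<and>\<^sub>f \<omega> i j h) x a b"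
  proof (cases "x \<in> X")
    case True
    \<comment> \<open>The second coordinate is eliminated between \<open>P_mat A\<close> and
      \<open>v * T x $ j - u\<close>. The coefficient of that coordinate in the latter is the
      constant \<open>v\<close>, so the form attached to it is 0. What remains is, up to sign, the
      linear function vanishing at the image of \<open>h p\<close>.\<close>
    have "(\<omega> i j h \<and>\<^sub>f \<omega>d j p) x a b =
      (\<omega>d i (h p) \<and>\<^sub>f (\<omega>d j p - \<omega> i j h) + 0 \<and>\<^sub>f (\<omega>d i (h p) - \<omega>d j p)
        + \<omega>d i (h pinf) \<and>\<^sub>f (\<omega> i j h - \<omega>d i (h p)) + \<omega>d i (h pinf) \<and>\<^sub>f 0) x a b"
    proof (rule wedge_three_term)
      show "- (?v * T x $ i - ?u) = (A$2$1 * T x $ i - A$1$1) * (v * T x $ j - u)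
          - v * P_mat A (T x $ i) (T x $ j)"
        by (simp add: P_mat_def algebra_simps)
      show "v \<noteq> 0" by fact
      show "- (?v * T x $ i - ?u) * \<omega>d i (h p) x w =
          (v * T x $ j - u) * ((A$2$1 * T x $ i - A$1$1) * \<omega>d i (h pinf) x w)
          + (A$2$1 * T x $ i - A$1$1) * ((v * T x $ j - u) * \<omega>d j p x w)
          - (P_mat A (T x $ i) (T x $ j) * (v * 0 x w)
            + v * (P_mat A (T x $ i) (T x $ j) * \<omega> i j h x w))" for w
        unfolding minus_mult_left[symmetric] diag_linear[OF True hp uv' hZhp] diag_linear[OF True p(1) uv]
          diag_image_pinf_linear(2)[OF True h A] pair_linear[OF True h ij A]
        by (simp add: algebra_simps)
    qed (fact P_mat_nonzero[OF True h ij A] linear_nonzero[OF True p(1) uv]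
        diag_image_pinf_linear(1)[OF True h A])+
    then show ?thesis
      by (simp add: wedge_diff_right diag_wedge_diag wedge_swap[of "\<omega>d i (h p)" "\<omega> i j h"])
  qed (simp add: wedge_def diag_outside pair_outside)
qed

text \<open>The shared coordinate \<open>T x $ k\<close> is eliminated. The two multipliers
  contribute the forms at \<open>h pinf\<close> and \<open>g pinf\<close>, and the remainder belongs
  to \<open>h\<close> times the inverse of \<open>g\<close>.\<close>

lemma pair_wedge_pair:
  assumes ij: "i \<noteq> j" "k \<noteq> i" "k \<noteq> j" and g: "g \<in> G" and h: "h \<in> G"
  shows "\<omega> i k h \<and>\<^sub>f \<omega> j k g =
    \<omega> i j (h \<otimes>\<^bsub>PGL2\<^esub> inv\<^bsub>PGL2\<^esub> g) \<and>\<^sub>f (\<omega> j k g - \<omega> i k h)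
    + \<omega>d j (g pinf) \<and>\<^sub>f (\<omega> i j (h \<otimes>\<^bsub>PGL2\<^esub> inv\<^bsub>PGL2\<^esub> g) - \<omega> j k g)
    + \<omega>d i (h pinf) \<and>\<^sub>f (\<omega> i k h - \<omega> i j (h \<otimes>\<^bsub>PGL2\<^esub> inv\<^bsub>PGL2\<^esub> g))
    + \<omega>d i (h pinf) \<and>\<^sub>f \<omega>d j (g pinf)" (is "?l = ?r")
proof (intro ext)
  fix x a b
  obtain A where A: "invertible A" "chart_conj h = homography A" using chart_conj_matrix h by blast
  obtain B where B: "invertible B" "chart_conj g = homography B" using chart_conj_matrix g by blast
  let ?f = "h \<otimes>\<^bsub>PGL2\<^esub> inv\<^bsub>PGL2\<^esub> g"
  have f: "?f \<in> G" using G_sub g h by (simp add: subgroup.m_closed subgroup.m_inv_closed)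
  have N: "invertible (A ** adj2 B)" "chart_conj ?f = homography (A ** adj2 B)"
    using A B g h by (auto intro: invertible_mult invertible_adj2 chart_conj_mult_inv_matrix)
  show "?l x a b = ?r x a b"
  proof (cases "x \<in> X")
    case True
    show ?thesis
    proof (rule wedge_three_term[OF P_mat_elimination])
      show "P_mat (A ** adj2 B) (T x $ i) (T x $ j) * \<omega> i j ?f x w =
        P_mat B (T x $ j) (T x $ k) * ((A$2$1 * T x $ i - A$1$1) * \<omega>d i (h pinf) x w)
        + (A$2$1 * T x $ i - A$1$1) * (P_mat B (T x $ j) (T x $ k) * \<omega> j k g x w)
        - (P_mat A (T x $ i) (T x $ k) * ((B$2$1 * T x $ j - B$1$1) * \<omega>d j (g pinf) x w)
          + (B$2$1 * T x $ j - B$1$1) * (P_mat A (T x $ i) (T x $ k) * \<omega> i k h x w))" for w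
        unfolding pair_linear[OF True f ij(1) N] pair_linear[OF True h ij(2)[symmetric] A]
          pair_linear[OF True g ij(3)[symmetric] B]
          diag_image_pinf_linear(2)[OF True h A] diag_image_pinf_linear(2)[OF True g B]
        \<comment> \<open>This is the elimination identity differentiated along
          \<open>dT x w\<close>.\<close>
        by (simp add: P_mat_def matrix_matrix_mult_def sum_2 algebra_simps)
    qed (fact P_mat_nonzero[OF True h ij(2)[symmetric] A] P_mat_nonzero[OF True g ij(3)[symmetric] B]
        diag_image_pinf_linear(1)[OF True h A] diag_image_pinf_linear(1)[OF True g B])+
  qed (simp add: wedge_def diag_outside pair_outside)
qed

lemma pair_wedge_same_pair:
  assumes ij: "i \<noteq> j" and g: "g \<in> G" and h: "h \<in> G" and hg: "h \<noteq> g"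
    and p: "p\<^sub>1 \<noteq> p\<^sub>2" "(h \<otimes>\<^bsub>PGL2\<^esub> inv\<^bsub>PGL2\<^esub> g) p\<^sub>1 = p\<^sub>1" "(h \<otimes>\<^bsub>PGL2\<^esub> inv\<^bsub>PGL2\<^esub> g) p\<^sub>2 = p\<^sub>2"
  shows "\<omega> i j h \<and>\<^sub>f \<omega> i j g =
    (\<omega>d i p\<^sub>1 + \<omega>d i p\<^sub>2) \<and>\<^sub>f (\<omega> i j g - \<omega> i j h)
    - \<omega>d i (g pinf) \<and>\<^sub>f \<omega> i j g + \<omega>d i (h pinf) \<and>\<^sub>f \<omega> i j h" (is "?l = ?r")
proof (intro ext)
  fix x a b
  obtain A where A: "invertible A" "chart_conj h = homography A" using chart_conj_matrix h by blast
  obtain B where B: "invertible B" "chart_conj g = homography B" using chart_conj_matrix g by blast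
  let ?f = "h \<otimes>\<^bsub>PGL2\<^esub> inv\<^bsub>PGL2\<^esub> g"
  define N where "N = A ** adj2 B"
  have f: "?f \<in> G" using G_sub g h by (simp add: subgroup.m_closed subgroup.m_inv_closed)
  have N: "invertible N" "chart_conj ?f = homography N"
    using A B g h by (auto simp: N_def intro: invertible_mult invertible_adj2 chart_conj_mult_inv_matrix)
  \<comment> \<open>Being nontrivial, \<open>?f\<close> has its fixed points in \<open>Z\<close> by
    \<open>stab\<close>, so the forms at both of them are covered by
    \<open>diag_linear\<close>.\<close>
  have "?f \<noteq> \<one>\<^bsub>PGL2\<^esub>"
    using hg g h by (metis G_carrier PGL.inv_closed PGL.inv_equality PGL.inv_inv)
  then have pZ: "p\<^sub>1 \<in> Z" "p\<^sub>2 \<in> Z" using stab f p by blast+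
  obtain u\<^sub>1 v\<^sub>1 where 1: "u\<^sub>1 \<noteq> 0 \<or> v\<^sub>1 \<noteq> 0" "hZ p\<^sub>1 = hom_pt u\<^sub>1 v\<^sub>1" by (rule hom_pt_cases)
  obtain u\<^sub>2 v\<^sub>2 where 2: "u\<^sub>2 \<noteq> 0 \<or> v\<^sub>2 \<noteq> 0" "hZ p\<^sub>2 = hom_pt u\<^sub>2 v\<^sub>2" by (rule hom_pt_cases)
  \<comment> \<open>The fixed points are the zeros of a binary quadratic form whose value at (y, 1)
    is \<open>P_mat N y y\<close>.\<close>
  have fixed: "N$2$1 * u\<^sup>2 + (N$2$2 - N$1$1) * (u * v) + (- N$1$2) * v\<^sup>2 = 0"
    if "u \<noteq> 0 \<or> v \<noteq> 0" "hZ q = hom_pt u v" "?f q = q" for u v q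
  proof -
    have "hom_pt (N$1$1 * u + N$1$2 * v) (N$2$1 * u + N$2$2 * v) = hom_pt u v"
      using that homography_hom_pt[of u v N] chart_conj_hZ[of ?f q] N(2) by simp
    then have "(N$1$1 * u + N$1$2 * v) * v = u * (N$2$1 * u + N$2$2 * v)"
      using hom_pt_eq_iff mult_vec_nonzero[OF N(1)] that by blast
    then show ?thesis by (simp add: power2_eq_square algebra_simps)
  qed
  have "u\<^sub>1 * v\<^sub>2 \<noteq> u\<^sub>2 * v\<^sub>1" using hom_pt_eq_iff[OF 1(1) 2(1)] 1(2) 2(2) p(1) hZ_eq_iff by metis
  then obtain c where c: "N$2$1 = c * (v\<^sub>1 * v\<^sub>2)" "N$2$2 - N$1$1 = - c * (u\<^sub>1 * v\<^sub>2 + u\<^sub>2 * v\<^sub>1)"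
    "- N$1$2 = c * (u\<^sub>1 * u\<^sub>2)"
    using binary_quadratic_factorization[OF fixed[OF 1 p(2)] fixed[OF 2 p(3)]] by blast
  have PN: "P_mat N y y = c * (v\<^sub>1 * y - u\<^sub>1) * (v\<^sub>2 * y - u\<^sub>2)" for y
  proof -
    have "P_mat N y y = N$2$1 * (y * y) + (N$2$2 - N$1$1) * y + (- N$1$2)"
      by (simp add: P_mat_def algebra_simps)
    then show ?thesis unfolding c by (simp add: algebra_simps)
  qed
  \<comment> \<open>The derivative of \<open>P_mat N y y\<close>, computed from the coefficients and
    from the factorization.\<close>
  have dPN: "2 * N$2$1 * y + (N$2$2 - N$1$1) = c * v\<^sub>1 * (v\<^sub>2 * y - u\<^sub>2) + c * v\<^sub>2 * (v\<^sub>1 * y - u\<^sub>1)" for y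
    unfolding c by (simp add: algebra_simps)
  show "?l x a b = ?r x a b"
  proof (cases "x \<in> X")
    case True
    \<comment> \<open>Logarithmic differentials turn the factorization into the sum of the forms at
      the two fixed points. If one of these is \<open>pinf\<close>, its factor is constant and its
      form is 0.\<close>
    have dR: "P_mat N (T x $ i) (T x $ i) * (\<omega>d i p\<^sub>1 + \<omega>d i p\<^sub>2) x w =
        \<kappa> * ((2 * N$2$1 * T x $ i + (N$2$2 - N$1$1)) * dT x w $ i)" for w
    proof -
      have "P_mat N (T x $ i) (T x $ i) * (\<omega>d i p\<^sub>1 + \<omega>d i p\<^sub>2) x w =
          c * (v\<^sub>2 * T x $ i - u\<^sub>2) * ((v\<^sub>1 * T x $ i - u\<^sub>1) * \<omega>d i p\<^sub>1 x w)
          + c * (v\<^sub>1 * T x $ i - u\<^sub>1) * ((v\<^sub>2 * T x $ i - u\<^sub>2) * \<omega>d i p\<^sub>2 x w)"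
        unfolding PN by (simp add: algebra_simps)
      also have "\<dots> = \<kappa> * ((2 * N$2$1 * T x $ i + (N$2$2 - N$1$1)) * dT x w $ i)"
        unfolding diag_linear[OF True pZ(1) 1] diag_linear[OF True pZ(2) 2] dPN
        by (simp add: algebra_simps)
      finally show ?thesis .
    qed
    have "?l x a b = ((\<omega>d i p\<^sub>1 + \<omega>d i p\<^sub>2) \<and>\<^sub>f (\<omega> i j g - \<omega> i j h)
        + \<omega>d i (g pinf) \<and>\<^sub>f ((\<omega>d i p\<^sub>1 + \<omega>d i p\<^sub>2) - \<omega> i j g)
        + \<omega>d i (h pinf) \<and>\<^sub>f (\<omega> i j h - (\<omega>d i p\<^sub>1 + \<omega>d i p\<^sub>2))
        + \<omega>d i (h pinf) \<and>\<^sub>f \<omega>d i (g pinf)) x a b"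
    proof (rule wedge_three_term[OF P_mat_elimination])
      show "P_mat (A ** adj2 B) (T x $ i) (T x $ i) * (\<omega>d i p\<^sub>1 + \<omega>d i p\<^sub>2) x w =
        P_mat B (T x $ i) (T x $ j) * ((A$2$1 * T x $ i - A$1$1) * \<omega>d i (h pinf) x w)
        + (A$2$1 * T x $ i - A$1$1) * (P_mat B (T x $ i) (T x $ j) * \<omega> i j g x w)
        - (P_mat A (T x $ i) (T x $ j) * ((B$2$1 * T x $ i - B$1$1) * \<omega>d i (g pinf) x w)
          + (B$2$1 * T x $ i - B$1$1) * (P_mat A (T x $ i) (T x $ j) * \<omega> i j h x w))" for w
        unfolding dR[unfolded N_def] pair_linear[OF True h ij A] pair_linear[OF True g ij B]
          diag_image_pinf_linear(2)[OF True h A] diag_image_pinf_linear(2)[OF True g B]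
        by (simp add: P_mat_def matrix_matrix_mult_def sum_2 algebra_simps)
    qed (fact P_mat_nonzero[OF True h ij A] P_mat_nonzero[OF True g ij B]
        diag_image_pinf_linear(1)[OF True h A] diag_image_pinf_linear(1)[OF True g B])+
    \<comment> \<open>All products of two diagonal forms vanish, as both carry the index
      \<open>i\<close>; this removes the surplus terms.\<close>
    then show ?thesis by (simp add: wedge_diff_right wedge_add_right diag_wedge_diag)
  qed (simp add: wedge_def diag_outside pair_outside)
qed

end

theorem proposition3p6:
  fixes G :: "(proj_line \<Rightarrow> proj_line) set" and Z :: "proj_line set"
    and pinf :: proj_line and hZ :: "proj_line \<Rightarrow> proj_line"
    and \<omega>d :: "'n::finite \<Rightarrow> proj_line \<Rightarrow> (proj_line^'n, complex^'n) form1"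
    and \<omega> :: "'n \<Rightarrow> 'n \<Rightarrow> (proj_line \<Rightarrow> proj_line) \<Rightarrow> (proj_line^'n, complex^'n) form1"
  assumes G_sub: "subgroup G PGL2" "finite G"
    and Z_stable: "finite Z" "\<forall>g\<in>G. g ` Z \<subseteq> Z"
    and stab: "{p. \<exists>g\<in>G. g \<noteq> \<one>\<^bsub>PGL2\<^esub> \<and> g p = p} \<subseteq> Z"
    and nontriv: "(G, Z) \<noteq> ({\<one>\<^bsub>PGL2\<^esub>}, {})"
    and pinf_in: "pinf \<in> Z"
    and hZ_hom: "hZ \<in> carrier PGL2" "hZ pinf = Infty"
    and normalized: "Infty \<in> Z \<longrightarrow> pinf = Infty \<and> hZ = \<one>\<^bsub>PGL2\<^esub>"
    and diag: "\<omega>d = omega_diag G Z pinf hZ"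
    and pair: "\<omega> = omega_pair G Z hZ"
  shows
    "(\<forall>i. \<forall>p\<in>Z - {pinf}. \<forall>q\<in>Z - {pinf}. \<omega>d i p \<and>\<^sub>f \<omega>d i q = 0) \<and>
     (\<forall>i j. i \<noteq> j \<longrightarrow> (\<forall>g\<in>G. \<omega> i j g = \<omega> j i (inv\<^bsub>PGL2\<^esub> g))) \<and>
     (\<forall>i j. i \<noteq> j \<longrightarrow> (\<forall>h\<in>G. \<forall>p\<in>Z - {pinf}.
        \<omega> i j h \<and>\<^sub>f \<omega>d j p =
          \<omega> i j h \<and>\<^sub>f \<omega>d i (h p) + \<omega>d i (h p) \<and>\<^sub>f \<omega>d j p + \<omega>d i (h pinf) \<and>\<^sub>f \<omega> i j h)) \<and>
     (\<forall>i j k. i \<noteq> j \<and> k \<noteq> i \<and> k \<noteq> j \<longrightarrow> (\<forall>g\<in>G. \<forall>h\<in>G.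
        \<omega> i k h \<and>\<^sub>f \<omega> j k g =
          \<omega> i j (h \<otimes>\<^bsub>PGL2\<^esub> inv\<^bsub>PGL2\<^esub> g) \<and>\<^sub>f (\<omega> j k g - \<omega> i k h)
          + \<omega>d j (g pinf) \<and>\<^sub>f (\<omega> i j (h \<otimes>\<^bsub>PGL2\<^esub> inv\<^bsub>PGL2\<^esub> g) - \<omega> j k g)
          + \<omega>d i (h pinf) \<and>\<^sub>f (\<omega> i k h - \<omega> i j (h \<otimes>\<^bsub>PGL2\<^esub> inv\<^bsub>PGL2\<^esub> g))
          + \<omega>d i (h pinf) \<and>\<^sub>f \<omega>d j (g pinf))) \<and>
     (\<forall>i j. i \<noteq> j \<longrightarrow> (\<forall>g\<in>G. \<forall>h\<in>G. h \<noteq> g \<longrightarrow>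
        (\<forall>p\<^sub>1 p\<^sub>2. p\<^sub>1 \<noteq> p\<^sub>2 \<and> {p. (h \<otimes>\<^bsub>PGL2\<^esub> inv\<^bsub>PGL2\<^esub> g) p = p} = {p\<^sub>1, p\<^sub>2} \<longrightarrow>
          \<omega> i j h \<and>\<^sub>f \<omega> i j g =
            (\<omega>d i p\<^sub>1 + \<omega>d i p\<^sub>2) \<and>\<^sub>f (\<omega> i j g - \<omega> i j h)
            - \<omega>d i (g pinf) \<and>\<^sub>f \<omega> i j g + \<omega>d i (h pinf) \<and>\<^sub>f \<omega> i j h)))"
proof -
  interpret orbit_forms G Z pinf hZ
    using G_sub(1) Z_stable(2) stab pinf_in hZ_hom by (rule orbit_forms.intro)
  show ?thesis
    unfolding diag pair
  proof (intro conjI allI ballI impI, goal_cases)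
    case 1
    show ?case by (rule diag_wedge_diag)
  next
    case 2
    then show ?case by (rule pair_swap)
  next
    case 3
    then show ?case by (intro pair_wedge_diag) auto
  next
    case (4 i j k g h)
    then show ?case by (intro pair_wedge_pair) auto
  next
    case (5 i j g h p\<^sub>1 p\<^sub>2)
    then show ?case by (intro pair_wedge_same_pair) auto
  qed
qed

end
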